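(* Let $\lambda=\frac{\ln 3}{\ln 4}$. Then, with $x$ ranging over the positive integers, $$\limsup_{x\to\infty} S_{3,0}(3x)\,x^{-\lambda}=\frac{55}{3}\left(\frac{3}{65}\right)^\lambda \qquad\text{and}\qquad \liminf_{x\to\infty} S_{3,0}(3x)\,x^{-\lambda}=\frac{2\sqrt{3}}{3}.$$
   Context: For a nonnegative integer $n$, $s(n)$ denotes the sum of the binary digits of $n$. For a nonnegative integer $x$, $$S_{3,0}(x)=\sum_{0\leq n<x,\ n\equiv 0 \pmod 3}(-1)^{s(n)},$$ so $S_{3,0}(x)$ is the difference between the numbers of multiples of 3 in $[0,x)$ with even and with odd binary digit sum. *)

theory Defs
  imports "HOL-Analysis.Analysis"
begin

fun binary_digit_sum :: "nat \<Rightarrow> nat" where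
  "binary_digit_sum n = (if n = 0 then 0 else n mod 2 + binary_digit_sum (n div 2))"

declare binary_digit_sum.simps [simp del]

definition S30 :: "nat \<Rightarrow> int" where
  "S30 x = (\<Sum>n | n < x \<and> n mod 3 = 0. (-1) ^ binary_digit_sum n)"

end

theory Submission
  imports Defs
begin

text \<open>
  Write \<open>eps n\<close> for $(-1)^{s(n)}$ and \<open>G x\<close> for $S_{3,0}(12x)/2$. Then \<open>G (4 x) = 3 G x\<close>, and
  $S_{3,0}(3x)$ differs from $\frac23 G(x)$ by at most $\frac13$, so it suffices to bound
  \<open>G x / x powr expo\<close> and to see that both bounds are approached.

  The increments of \<open>G\<close> over a block $[m4^k, (m+1)4^k]$ depend only on the signs
  \<open>eps (3 m)\<close>, \<open>eps (3 m + 1)\<close>, \<open>eps (3 m + 2)\<close>, because multiplying a base 4 expansion by 3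
  carries at most 2 into \<open>3 m\<close>. Up to a global sign there are three patterns:
  $A = ({+}{-}{-})$, $B = ({+}{+}{-})$ and $C = ({+}{-}{+})$. Appending the base 4 digits 0, 1, 2, 3
  takes $A$ to $A, C, A, B$, takes $B$ to $A, B, -C, B$, and takes $C$ to $A, C, C, -B$.

  The minimum is at \<open>x = 2\<close>. Since \<open>G (2 * 4 ^ k + r) = G (2 * 4 ^ k) + G r\<close>, the lower bound
  reduces near it to subadditivity of \<open>x powr expo\<close>. The maximum is at the non-dyadic point
  $65/3 = 111.222\ldots_4$, inside a block with pattern $C$. There \<open>G\<close> stays below a linear
  function on the left and below its peak value on the right, so concavity of \<open>x powr expo\<close> gives
  the upper bound. Finitely many rational comparisons settle all other blocks.
\<close>

section \<open>Signs of binary digit sums\<close>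

definition eps :: "nat \<Rightarrow> int" where
  "eps n = (-1) ^ binary_digit_sum n"

lemma eps_0 [simp]: "eps 0 = 1"
  by (simp add: eps_def binary_digit_sum.simps)

lemma eps_double: "eps (2 * n) = eps n"
  by (cases "n = 0") (simp_all add: eps_def binary_digit_sum.simps[of "2 * n"])

lemma eps_double_Suc: "eps (2 * n + 1) = - eps n"
  by (simp add: eps_def binary_digit_sum.simps[of "Suc (2 * n)"])

lemma eps_quad:
  "eps (4 * n) = eps n" "eps (4 * n + 1) = - eps n"
  "eps (4 * n + 2) = - eps n" "eps (4 * n + 3) = eps n"
  using eps_double[of "2 * n"] eps_double_Suc[of "2 * n"] eps_double[of "2 * n + 1"]
    eps_double_Suc[of "2 * n + 1"] eps_double[of n] eps_double_Suc[of n]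
  by (simp_all add: algebra_simps eval_nat_numeral)

lemma abs_eps: "\<bar>eps n\<bar> = 1"
  by (simp add: eps_def power_abs)

lemma eps_numeral [simp]:
  "eps 1 = -1" "eps (Suc 0) = -1" "eps (Suc (Suc 0)) = -1"
  "eps (numeral (Num.Bit0 w)) = eps (numeral w)"
  "eps (numeral (Num.Bit1 w)) = - eps (numeral w)"
  using eps_double_Suc[of 0] eps_double[of 1] eps_double[of "numeral w"] eps_double_Suc[of "numeral w"]
  by (simp_all add: numeral_Bit0 numeral_Bit1 mult_2 numeral_2_eq_2)

section \<open>Multiples of three in blocks of four, and quadrupling\<close>

lemma S30_0 [simp]: "S30 0 = 0"
  by (simp add: S30_def)

lemma S30_step: "S30 (3 * Suc n) = S30 (3 * n) + eps (3 * n)"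
proof -
  have "{i. i < 3 * Suc n \<and> i mod 3 = 0} = insert (3 * n) {i. i < 3 * n \<and> i mod 3 = 0}"
    by (auto; presburger)
  then show ?thesis
    by (simp add: S30_def eps_def)
qed

text \<open>Written as \<open>4 * q + c\<close>, the multiples of 3 from \<open>12 * m\<close> on
  have \<open>q\<close> equal to \<open>3 * m\<close>, \<open>3 * m\<close>,
  \<open>3 * m + 1\<close>, \<open>3 * m + 2\<close> and \<open>c\<close> equal to 0, 3, 2, 1; the
  last two digits flip the sign.\<close>

lemma S30_block:
  "S30 (3 * (4 * m + 1)) = S30 (3 * (4 * m)) + eps (3 * m)"
  "S30 (3 * (4 * m + 2)) = S30 (3 * (4 * m)) + 2 * eps (3 * m)"
  "S30 (3 * (4 * m + 3)) = S30 (3 * (4 * m)) + 2 * eps (3 * m) - eps (3 * m + 1)"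
  "S30 (3 * (4 * m + 4)) = S30 (3 * (4 * m)) + 2 * eps (3 * m) - eps (3 * m + 1) - eps (3 * m + 2)"
proof -
  have 1: "eps (3 * (4 * m)) = eps (3 * m)"
    using eps_quad(1)[of "3 * m"] by (simp add: algebra_simps)
  have 2: "eps (3 * (4 * m + 1)) = eps (3 * m)"
    using eps_quad(4)[of "3 * m"] by (simp add: algebra_simps)
  have 3: "eps (3 * (4 * m + 2)) = - eps (3 * m + 1)"
    using eps_quad(3)[of "3 * m + 1"] by (simp add: algebra_simps)
  have 4: "eps (3 * (4 * m + 3)) = - eps (3 * m + 2)"
    using eps_quad(2)[of "3 * m + 2"] by (simp add: algebra_simps)
  have s: "S30 (3 * (n + 1)) = S30 (3 * n) + eps (3 * n)" for n
    using S30_step[of n] by simp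
  show a: "S30 (3 * (4 * m + 1)) = S30 (3 * (4 * m)) + eps (3 * m)"
    using s[of "4 * m"] 1 by simp
  show b: "S30 (3 * (4 * m + 2)) = S30 (3 * (4 * m)) + 2 * eps (3 * m)"
    using s[of "4 * m + 1"] 2 a by (simp add: algebra_simps)
  show c: "S30 (3 * (4 * m + 3)) = S30 (3 * (4 * m)) + 2 * eps (3 * m) - eps (3 * m + 1)"
    using s[of "4 * m + 2"] 3 b by (simp add: algebra_simps)
  show "S30 (3 * (4 * m + 4)) = S30 (3 * (4 * m)) + 2 * eps (3 * m) - eps (3 * m + 1) - eps (3 * m + 2)"
    using s[of "4 * m + 3"] 4 c by (simp add: algebra_simps)
qed

text \<open>Over a pair of indices the terms \<open>eps (3 * j + 2)\<close> cancel, and the finer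
  sum grows by \<open>3 * (eps (3 * j) - eps (3 * j + 1))\<close>, three times the growth of the
  coarser one. Halfway through a pair one sign remains as an error.\<close>

lemma S30_quad_even: "S30 (3 * (4 * (2 * j))) = 3 * S30 (3 * (2 * j))"
  and S30_quad_odd: "S30 (3 * (4 * (2 * j + 1))) = 3 * S30 (3 * (2 * j + 1)) - eps (3 * j + 1)"
proof -
  have ev: "eps (3 * (2 * j)) = eps (3 * j)" "eps (3 * (2 * j) + 1) = - eps (3 * j)"
     "eps (3 * (2 * j) + 2) = eps (3 * j + 1)" for j
    using eps_double[of "3 * j"] eps_double_Suc[of "3 * j"] eps_double[of "3 * j + 1"]
    by (simp_all add: algebra_simps)
  have od: "eps (3 * (2 * j + 1)) = - eps (3 * j + 1)" "eps (3 * (2 * j + 1) + 1) = eps (3 * j + 2)"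
     "eps (3 * (2 * j + 1) + 2) = - eps (3 * j + 2)" for j
    using eps_double_Suc[of "3 * j + 1"] eps_double[of "3 * j + 2"] eps_double_Suc[of "3 * j + 2"]
    by (simp_all add: algebra_simps eval_nat_numeral)
  have step1: "S30 (3 * (4 * (2 * j + 1))) = S30 (3 * (4 * (2 * j))) + 3 * eps (3 * j) - eps (3 * j + 1)"
    "S30 (3 * (2 * j + 1)) = S30 (3 * (2 * j)) + eps (3 * j)" for j
    using S30_block(4)[of "2 * j"] S30_step[of "2 * j"] ev[of j] by (simp_all add: algebra_simps)
  have step2: "S30 (3 * (4 * (2 * Suc j))) = S30 (3 * (4 * (2 * j + 1))) - 2 * eps (3 * j + 1)"
    "S30 (3 * (2 * Suc j)) = S30 (3 * (2 * j + 1)) - eps (3 * j + 1)" for j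
    using S30_block(4)[of "2 * j + 1"] S30_step[of "2 * j + 1"] od[of j]
    by (simp_all add: algebra_simps)
  show even: "S30 (3 * (4 * (2 * j))) = 3 * S30 (3 * (2 * j))"
  proof (induction j)
    case (Suc j)
    then show ?case
      using step1[of j] step2[of j] by linarith
  qed simp
  show "S30 (3 * (4 * (2 * j + 1))) = 3 * S30 (3 * (2 * j + 1)) - eps (3 * j + 1)"
    using even step1[of j] by linarith
qed

lemma S30_quad_bound: "\<bar>S30 (3 * (4 * x)) - 3 * S30 (3 * x)\<bar> \<le> 1"
proof (cases "even x")
  case True
  then obtain j where "x = 2 * j" by blast
  then show ?thesis
    using S30_quad_even[of j] by simp
next
  case False
  then obtain j where "x = 2 * j + 1" using oddE by blast
  then show ?thesis
    using S30_quad_odd[of j] abs_eps[of "3 * j + 1"] by simp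
qed

section \<open>An exactly scaling sum\<close>

text \<open>Sampling at the even argument \<open>4 * n\<close> makes scaling by 4 exact, whereas
  \<open>S30 (3 * x)\<close> misses it by one at odd \<open>x\<close>. The values remain integers
  after halving.\<close>

definition G :: "nat \<Rightarrow> real" where
  "G n = S30 (3 * (4 * n)) / 2"

lemma G_0 [simp]: "G 0 = 0"
  by (simp add: G_def)

lemma G_step: "G (m + 1) = G m + (2 * eps (3 * m) - eps (3 * m + 1) - eps (3 * m + 2)) / 2"
  using S30_block(4)[of m] by (simp add: G_def algebra_simps add_divide_distrib diff_divide_distrib)

lemma G_quad: "G (4 * m) = 3 * G m"
  using S30_quad_even[of "2 * m"] by (simp add: G_def)

lemma G_power: "G (4 ^ k * m) = 3 ^ k * G m"
  by (induction k) (simp_all add: G_quad mult.assoc)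

text \<open>\<open>3 * (4 * m + d) + c\<close> is \<open>4 * (3 * m) + (3 * d + c)\<close>, and
  \<open>3 * d + c\<close> is at most 11 for \<open>c\<close> up to 2, so the carry into
  \<open>3 * m\<close> is again 0, 1 or 2.\<close>

lemma eps_child:
  "eps (3 * (4 * m)) = eps (3 * m)" "eps (3 * (4 * m) + 1) = - eps (3 * m)"
  "eps (3 * (4 * m) + 2) = - eps (3 * m)"
  "eps (3 * (4 * m + 1)) = eps (3 * m)" "eps (3 * (4 * m + 1) + 1) = eps (3 * m + 1)"
  "eps (3 * (4 * m + 1) + 2) = - eps (3 * m + 1)"
  "eps (3 * (4 * m + 2)) = - eps (3 * m + 1)" "eps (3 * (4 * m + 2) + 1) = eps (3 * m + 1)"
  "eps (3 * (4 * m + 2) + 2) = eps (3 * m + 2)"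
  "eps (3 * (4 * m + 3)) = - eps (3 * m + 2)" "eps (3 * (4 * m + 3) + 1) = - eps (3 * m + 2)"
  "eps (3 * (4 * m + 3) + 2) = eps (3 * m + 2)"
  using eps_quad[of "3 * m"] eps_quad[of "3 * m + 1"] eps_quad[of "3 * m + 2"]
  by (simp_all add: algebra_simps)

lemma G_child:
  "G (4 * m + 1) = 3 * G m + 2 * eps (3 * m)"
  "G (4 * m + 2) = 3 * G m + 3 * eps (3 * m)"
  "G (4 * m + 3) = 3 * G m + 3 * eps (3 * m) - 3 / 2 * eps (3 * m + 1) - 1 / 2 * eps (3 * m + 2)"
proof -
  show 1: "G (4 * m + 1) = 3 * G m + 2 * eps (3 * m)"
    using G_step[of "4 * m"] by (simp only: eps_child G_quad) (simp add: field_simps)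
  show 2: "G (4 * m + 2) = 3 * G m + 3 * eps (3 * m)"
    using G_step[of "4 * m + 1"] by (simp only: eps_child 1) (simp add: field_simps)
  show "G (4 * m + 3) = 3 * G m + 3 * eps (3 * m) - 3 / 2 * eps (3 * m + 1) - 1 / 2 * eps (3 * m + 2)"
    using G_step[of "4 * m + 2"] by (simp only: eps_child 2) (simp add: field_simps eval_nat_numeral)
qed

section \<open>Self-similarity of blocks\<close>

text \<open>Blocks are closed at both ends, so that bounds include the right endpoint; a common
  endpoint of two blocks may be split either way.\<close>

lemma split_block:
  fixes r :: nat
  assumes "r \<le> 4 ^ Suc k"
  obtains d r' where "d \<in> {0, 1, 2, 3}" "r' \<le> 4 ^ k" "r = d * 4 ^ k + r'"
proof -
  define P where "P = (4::nat) ^ k"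
  have "r \<le> 4 * P" using assms by (simp add: P_def)
  then consider "r \<le> P" | "P \<le> r" "r \<le> 2 * P" | "2 * P \<le> r" "r \<le> 3 * P" | "3 * P \<le> r" "r \<le> 4 * P"
    by linarith
  then show thesis
  proof cases
    case 1 then show thesis using that[of 0 r] by (simp add: P_def)
  next
    case 2 then show thesis using that[of 1 "r - P"] by (simp add: P_def)
  next
    case 3 then show thesis using that[of 2 "r - 2 * P"] by (simp add: P_def)
  next
    case 4 then show thesis using that[of 3 "r - 3 * P"] by (simp add: P_def)
  qed
qed

text \<open>Appending the first digit of \<open>r\<close> to \<open>m\<close> and \<open>m'\<close>
  keeps their sign patterns proportional, because child signs and increments are linear in the three
  signs.\<close>

lemma G_state:
  fixes m m' r k :: nat and \<sigma> :: int
  assumes "r \<le> 4 ^ k" "eps (3 * m) = \<sigma> * eps (3 * m')" "eps (3 * m + 1) = \<sigma> * eps (3 * m' + 1)"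
    "eps (3 * m + 2) = \<sigma> * eps (3 * m' + 2)"
  shows "G (m * 4 ^ k + r) - 3 ^ k * G m = \<sigma> * (G (m' * 4 ^ k + r) - 3 ^ k * G m')"
  using assms
proof (induction k arbitrary: m m' r)
  case 0
  then have "r = 0 \<or> r = 1" by auto
  moreover have "G (m + 1) - G m = \<sigma> * (G (m' + 1) - G m')"
    unfolding G_step 0 by (simp add: algebra_simps add_divide_distrib diff_divide_distrib)
  ultimately show ?case
    by auto
next
  case (Suc k)
  obtain d r' where d: "d \<in> {0, 1, 2, 3}" and r': "r' \<le> 4 ^ k" and r: "r = d * 4 ^ k + r'"
    using split_block Suc.prems(1) by metis
  note e = Suc.prems(2-4)
  have IH: "G ((4 * m + d) * 4 ^ k + r') - 3 ^ k * G (4 * m + d)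
      = \<sigma> * (G ((4 * m' + d) * 4 ^ k + r') - 3 ^ k * G (4 * m' + d))"
  proof (rule Suc.IH[OF r'])
    show "eps (3 * (4 * m + d)) = \<sigma> * eps (3 * (4 * m' + d))"
      "eps (3 * (4 * m + d) + 1) = \<sigma> * eps (3 * (4 * m' + d) + 1)"
      "eps (3 * (4 * m + d) + 2) = \<sigma> * eps (3 * (4 * m' + d) + 2)"
      using d by (elim insertE emptyE; simp only: eps_child add_0_right e; simp)+
  qed
  have "G (4 * m + d) - 3 * G m = \<sigma> * (G (4 * m' + d) - 3 * G m')"
    using d by (elim insertE emptyE;
      simp only: G_child G_quad add_0_right e of_int_mult; simp add: algebra_simps)
  then have "3 ^ k * (G (4 * m + d) - 3 * G m) = 3 ^ k * (\<sigma> * (G (4 * m' + d) - 3 * G m'))"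
    by simp
  moreover have "m * 4 ^ Suc k + r = (4 * m + d) * 4 ^ k + r'" "m' * 4 ^ Suc k + r = (4 * m' + d) * 4 ^ k + r'"
    by (simp_all add: r algebra_simps)
  ultimately show ?case
    using IH by (simp add: algebra_simps)
qed

lemma G_small:
  "G (Suc 0) = 2" "G 2 = 3" "G 3 = 5" "G 4 = 6" "G 5 = 8" "G 6 = 9" "G 7 = 10"
  "G 12 = 15" "G 13 = 17" "G 14 = 18" "G 15 = 17"
  using G_child[of 0] G_child[of 1] G_quad[of 1] G_child[of 3] G_quad[of 3]
  by (simp_all add: numeral_2_eq_2)

text \<open>
  The patterns $A$, $C$, $B$ occur at \<open>m = 0, 1, 3\<close>. Hence \<open>G r\<close>, \<open>C k r\<close> and \<open>B k r\<close>, for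
  \<open>r \<le> 4 ^ k\<close>, are the increments of \<open>G\<close> inside a block of the respective pattern.
\<close>

definition C :: "nat \<Rightarrow> nat \<Rightarrow> real" where
  "C k r = G (4 ^ k + r) - 2 * 3 ^ k"

definition B :: "nat \<Rightarrow> nat \<Rightarrow> real" where
  "B k r = G (3 * 4 ^ k + r) - 5 * 3 ^ k"

lemma G_cells:
  assumes "r \<le> 4 ^ k"
  shows "G (4 ^ k + r) = 2 * 3 ^ k + C k r"
    "G (2 * 4 ^ k + r) = 3 * 3 ^ k + G r"
    "G (3 * 4 ^ k + r) = 5 * 3 ^ k + B k r"
  using G_state[of r k 2 1 0] assms by (simp_all add: C_def B_def G_small)

text \<open>Blocks 4 to 7 are the children of block 1. Block 7 has pattern B with all signs
  reversed, hence the factor \<open>-1\<close> and the minus sign.\<close>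

lemma C_cells:
  assumes "r \<le> 4 ^ k"
  shows "C (Suc k) r = G r"
    "C (Suc k) (4 ^ k + r) = 2 * 3 ^ k + C k r"
    "C (Suc k) (2 * 4 ^ k + r) = 3 * 3 ^ k + C k r"
    "C (Suc k) (3 * 4 ^ k + r) = 4 * 3 ^ k - B k r"
  using G_state[of r k 4 1 0] G_state[of r k 5 1 1] G_state[of r k 6 1 1] G_state[of r k 7 "-1" 3] assms
  by (simp_all add: C_def B_def G_small algebra_simps)

lemma B_cells:
  assumes "r \<le> 4 ^ k"
  shows "B (Suc k) r = G r"
    "B (Suc k) (4 ^ k + r) = 2 * 3 ^ k + B k r"
    "B (Suc k) (2 * 4 ^ k + r) = 3 * 3 ^ k - C k r"
    "B (Suc k) (3 * 4 ^ k + r) = 2 * 3 ^ k + B k r"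
  using G_state[of r k 12 1 0] G_state[of r k 13 1 3] G_state[of r k 14 "-1" 1] G_state[of r k 15 1 3] assms
  by (simp_all add: C_def B_def G_small algebra_simps)


section \<open>Uniform bounds inside blocks\<close>

lemma real_le_four_power: "r \<le> 4 ^ k \<Longrightarrow> real r \<le> 4 ^ k"
  using of_nat_mono[of r "4 ^ k", where 'a = real] by simp

text \<open>The patterns feed into each other, so one induction treats all of them. The upper
  constants are closed under the digit recursion: \<open>5 + 1 = 3 * 2\<close>,
  \<open>3 + 3 / 2 = 3 * (3 / 2)\<close> and \<open>2 + 1 = 3 * 1\<close>.\<close>

lemma block_bounds:
  assumes "r \<le> 4 ^ k"
  shows "0 \<le> G r \<and> G r \<le> 2 * 3 ^ k \<and> 0 \<le> C k r \<and> C k r \<le> 3 / 2 * 3 ^ k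
    \<and> 0 \<le> B k r \<and> B k r \<le> 3 ^ k"
  using assms
proof (induction k arbitrary: r)
  case 0
  then have "r = 0 \<or> r = 1" by auto
  then show ?case
    by (auto simp: C_def B_def G_small simp flip: numeral_2_eq_2)
next
  case (Suc k)
  obtain d r' where d: "d \<in> {0, 1, 2, 3}" and r': "r' \<le> 4 ^ k" and r: "r = d * 4 ^ k + r'"
    using split_block Suc.prems by metis
  have "(0::real) < 3 ^ k" by simp
  with d Suc.IH[OF r'] show ?case
    unfolding r by (auto simp: G_cells[OF r'] C_cells[OF r'] B_cells[OF r'])
qed

lemma G_nonneg: "r \<le> 4 ^ k \<Longrightarrow> 0 \<le> G r"
  and G_le: "r \<le> 4 ^ k \<Longrightarrow> G r \<le> 2 * 3 ^ k"
  and C_nonneg: "r \<le> 4 ^ k \<Longrightarrow> 0 \<le> C k r"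
  and C_le: "r \<le> 4 ^ k \<Longrightarrow> C k r \<le> 3 / 2 * 3 ^ k"
  and B_nonneg: "r \<le> 4 ^ k \<Longrightarrow> 0 \<le> B k r"
  and B_le: "r \<le> 4 ^ k \<Longrightarrow> B k r \<le> 3 ^ k"
  using block_bounds by blast+

text \<open>Only the last quarter, which starts at height \<open>5 * 3 ^ j\<close>, can rise above
  this. The block just left of the one containing the maximum needs the gain over
  \<open>2 * 3 ^ k\<close>.\<close>

lemma G_le_initial:
  assumes "4 * r \<le> 3 * 4 ^ k"
  shows "G r \<le> 5 / 3 * 3 ^ k"
proof (cases k)
  case 0
  with assms have "r = 0" by simp
  then show ?thesis by simp
next
  case (Suc j)
  have r_le: "r \<le> 4 ^ Suc j" using assms Suc by simp
  obtain d r' where d: "d \<in> {0, 1, 2, 3}" and r': "r' \<le> 4 ^ j" and r: "r = d * 4 ^ j + r'"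
    using split_block[OF r_le] by metis
  have T: "(0::real) < 3 ^ j" by simp
  consider "d = 0" | "d = 1" | "d = 2" | "d = 3" "r' = 0"
    using d r assms Suc by auto
  then have "G r \<le> 5 * 3 ^ j"
  proof cases
    case 1
    then have "G r \<le> 2 * 3 ^ j" using r G_le[OF r'] by simp
    then show ?thesis using T by linarith
  next
    case 2
    then have "G r \<le> 2 * 3 ^ j + 3 / 2 * 3 ^ j" using r C_le[OF r'] G_cells(1)[OF r'] by simp
    then show ?thesis using T by linarith
  next
    case 3
    then show ?thesis using r G_le[OF r'] G_cells(2)[OF r'] by simp
  next
    case 4
    then show ?thesis using r G_power[of j 3] by (simp add: G_small mult.commute)
  qed
  then show ?thesis using Suc by simp
qed

text \<open>The last quarter is again a block of pattern B, entered at height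
  \<open>2 * 3 ^ j\<close>, and \<open>B\<close> is nonnegative.\<close>

lemma B_ge_final:
  assumes "3 * 4 ^ k \<le> 4 * r" "r \<le> 4 ^ k"
  shows "2 / 3 * 3 ^ k \<le> B k r"
proof (cases k)
  case 0
  with assms have "r = 1" by simp
  with 0 show ?thesis by (simp add: B_def G_small)
next
  case (Suc j)
  define r' where "r' = r - 3 * 4 ^ j"
  have "r = 3 * 4 ^ j + r'" "r' \<le> 4 ^ j"
    using assms Suc by (simp_all add: r'_def)
  then show ?thesis
    using B_nonneg[of r' j] Suc by (simp add: B_cells)
qed

text \<open>The line passes through the peak of \<open>C\<close>, of height $\frac32 3^k$ at $r = \frac23 4^k$.\<close>

lemma C_le_linear:
  assumes "r \<le> 4 ^ k"
  shows "C k r \<le> (3 / 4 + 9 / 8 * (r / 4 ^ k)) * 3 ^ k"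
  using assms
proof (induction k arbitrary: r)
  case 0
  then have "r = 0 \<or> r = 1" by auto
  then show ?case
    by (auto simp: C_def G_small simp flip: numeral_2_eq_2)
next
  case (Suc k)
  obtain d r' where d: "d \<in> {0, 1, 2, 3}" and r': "r' \<le> 4 ^ k" and r: "r = d * 4 ^ k + r'"
    using split_block Suc.prems by metis
  define t where "t = real r' / 4 ^ k"
  define T where "T = (3::real) ^ k"
  have T: "T > 0" by (simp add: T_def)
  have t: "0 \<le> t" "t \<le> 1"
    using real_le_four_power[OF r'] by (simp_all add: t_def)
  have rt: "real r / 4 ^ Suc k = (d + t) / 4"
    by (simp add: r t_def field_simps)
  have IH: "C k r' \<le> (3 / 4 + 9 / 8 * t) * T"
    using Suc.IH[OF r'] by (simp add: t_def T_def)
  have goal: "(3 / 4 + 9 / 8 * (real r / 4 ^ Suc k)) * 3 ^ Suc k = 9 / 4 * T + 27 / 32 * (d * T) + 27 / 32 * (t * T)"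
    unfolding rt T_def by (simp add: field_simps)
  have tT: "0 \<le> t * T" "t * T \<le> T" using t T by simp_all
  have Cb: "C k r' \<le> 3 / 2 * T" using C_le[OF r'] by (simp add: T_def)
  consider "d = 0" | "d = 1" | "d = 2" | "d = 3" using d by auto
  then show ?case
  proof cases
    case 1
    then have "C (Suc k) r \<le> 2 * T" "real d * T = 0"
      using C_cells(1)[OF r'] G_le[OF r'] r by (simp_all add: T_def)
    then show ?thesis
      unfolding goal using tT T by linarith
  next
    case 2
    have "C k r' \<le> 3 / 4 * T + 9 / 8 * (t * T)" using IH by (simp add: algebra_simps)
    moreover have "C (Suc k) r = 2 * T + C k r'" "real d * T = T"
      using C_cells(2)[OF r'] r 2 by (simp_all add: T_def)
    ultimately show ?thesis
      unfolding goal using tT T by linarith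
  next
    case 3
    \<comment> \<open>The induction hypothesis has slope 9/8, the required line only 27/32. They
      cross at \<open>t = 2 / 3\<close> at height 3/2; beyond that point the constant bound 3/2
      suffices.\<close>
    have "C k r' \<le> (15 / 16 + 27 / 32 * t) * T"
    proof (cases "t \<le> 2 / 3")
      case True
      then have "t * T \<le> 2 / 3 * T" using T by (intro mult_right_mono) auto
      then show ?thesis using IH by (simp add: algebra_simps)
    next
      case False
      then have "2 / 3 * T \<le> t * T" using T by (intro mult_right_mono) auto
      then show ?thesis using Cb by (simp add: algebra_simps)
    qed
    then show ?thesis
      unfolding goal using C_cells(3)[OF r'] 3 r by (simp add: algebra_simps flip: T_def)
  next
    case 4
    then show ?thesis
      unfolding goal using C_cells(4)[OF r'] B_nonneg[OF r'] tT T r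
      by (simp add: algebra_simps flip: T_def)
  qed
qed

section \<open>The exponent and rational comparisons of powers\<close>

definition expo :: real where
  "expo = ln 3 / ln 4"

text \<open>Two consecutive convergents of the exponent, from \<open>4 ^ 19 <= 3 ^ 24\<close> and
  \<open>3 ^ 5 <= 4 ^ 4\<close>. They turn comparisons with \<open>x powr expo\<close> into rational
  ones; the lower convergent is just sharp enough for \<open>U (68 / 3)\<close>.\<close>

lemma expo_bounds: "19 / 24 \<le> expo" "expo \<le> 4 / 5"
proof -
  have 4: "ln (4::real) > 0" by simp
  have "19 * ln (4::real) = ln (4 ^ 19)" by (subst ln_realpow) simp_all
  also have "\<dots> \<le> ln (3 ^ 24)" by (subst ln_le_cancel_iff) simp_all
  also have "\<dots> = 24 * ln 3" by (subst ln_realpow) simp_all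
  finally show "19 / 24 \<le> expo" using 4 by (simp add: expo_def field_simps)
  have "5 * ln (3::real) = ln (3 ^ 5)" by (subst ln_realpow) simp_all
  also have "\<dots> \<le> ln (4 ^ 4)" by (subst ln_le_cancel_iff) simp_all
  also have "\<dots> = 4 * ln 4" by (subst ln_realpow) simp_all
  finally show "expo \<le> 4 / 5" using 4 by (simp add: expo_def field_simps)
qed

lemma four_powr_expo: "4 powr expo = 3"
  by (simp add: expo_def powr_def)

lemma two_powr_expo: "2 powr expo = sqrt 3"
proof -
  have "(2 powr expo)\<^sup>2 = (2 * 2) powr expo"
    unfolding power2_eq_square by (subst powr_mult) simp_all
  then show ?thesis
    using four_powr_expo by (intro real_sqrt_unique[symmetric]) simp_all
qed

lemma four_power_powr_expo: "(4 ^ k) powr expo = 3 ^ k"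
proof -
  have "(4 ^ k) powr expo = (4 powr expo) ^ k"
    by (simp add: powr_powr mult.commute flip: powr_realpow)
  then show ?thesis by (simp add: four_powr_expo)
qed

lemma powr_frac_power:
  fixes x :: real
  assumes "0 < x" "q > 0"
  shows "(x powr (real p / real q)) ^ q = x ^ p"
  using assms by (simp add: powr_powr flip: powr_realpow)

lemma powr_expo_bounds_ge_1:
  fixes x L :: real
  assumes "1 \<le> x"
  shows "L ^ 24 \<le> x ^ 19 \<Longrightarrow> L \<le> x powr expo" "0 \<le> L \<Longrightarrow> x ^ 4 \<le> L ^ 5 \<Longrightarrow> x powr expo \<le> L"
proof -
  assume "L ^ 24 \<le> x ^ 19"
  then have "L ^ 24 \<le> (x powr (real 19 / real 24)) ^ 24"
    using assms by (subst powr_frac_power) auto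
  then have "L \<le> x powr (real 19 / real 24)"
    using power_le_imp_le_base[of L 23 "x powr (real 19 / real 24)"] by simp
  also have "\<dots> \<le> x powr expo"
    using assms expo_bounds by (intro powr_mono) auto
  finally show "L \<le> x powr expo" .
next
  assume L: "0 \<le> L" "x ^ 4 \<le> L ^ 5"
  then have "(x powr (real 4 / real 5)) ^ 5 \<le> L ^ 5"
    using assms by (subst powr_frac_power) auto
  then have "x powr (real 4 / real 5) \<le> L"
    using L power_le_imp_le_base[of "x powr (real 4 / real 5)" 4 L] by simp
  moreover have "x powr expo \<le> x powr (real 4 / real 5)"
    using assms expo_bounds by (intro powr_mono) auto
  ultimately show "x powr expo \<le> L" by linarith
qed

lemma powr_expo_bounds_le_1:
  fixes x L :: real
  assumes "0 < x" "x \<le> 1"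
  shows "L ^ 5 \<le> x ^ 4 \<Longrightarrow> L \<le> x powr expo" "0 \<le> L \<Longrightarrow> x ^ 19 \<le> L ^ 24 \<Longrightarrow> x powr expo \<le> L"
proof -
  assume "L ^ 5 \<le> x ^ 4"
  then have "L ^ 5 \<le> (x powr (real 4 / real 5)) ^ 5"
    using assms by (subst powr_frac_power) auto
  then have "L \<le> x powr (real 4 / real 5)"
    using power_le_imp_le_base[of L 4 "x powr (real 4 / real 5)"] by simp
  also have "\<dots> \<le> x powr expo"
    using assms expo_bounds by (intro powr_mono') auto
  finally show "L \<le> x powr expo" .
next
  assume L: "0 \<le> L" "x ^ 19 \<le> L ^ 24"
  then have "(x powr (real 19 / real 24)) ^ 24 \<le> L ^ 24"
    using assms by (subst powr_frac_power) auto
  then have "x powr (real 19 / real 24) \<le> L"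
    using L power_le_imp_le_base[of "x powr (real 19 / real 24)" 23 L] by simp
  moreover have "x powr expo \<le> x powr (real 19 / real 24)"
    using assms expo_bounds by (intro powr_mono') auto
  ultimately show "x powr expo \<le> L" by linarith
qed

text \<open>The shares of \<open>x\<close> and \<open>y\<close> in \<open>x + y\<close> lie in
  [0, 1] and sum to 1, and each is at most its own power with exponent \<open>a\<close>.\<close>

lemma powr_subadditive:
  fixes x y a :: real
  assumes "0 \<le> x" "0 \<le> y" "0 \<le> a" "a \<le> 1"
  shows "(x + y) powr a \<le> x powr a + y powr a"
proof (cases "x + y = 0")
  case False
  then have s: "x + y > 0" using assms by simp
  have frac: "z / (x + y) \<le> (z / (x + y)) powr a" if "0 \<le> z" "z \<le> x + y" for z
  proof (cases "z = 0")
    case False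
    have "(z / (x + y)) powr 1 \<le> (z / (x + y)) powr a"
      using that s assms by (intro powr_mono') auto
    then show ?thesis using that s by simp
  qed simp
  have "1 = x / (x + y) + y / (x + y)"
    using s by (simp flip: add_divide_distrib)
  also have "\<dots> \<le> (x / (x + y)) powr a + (y / (x + y)) powr a"
    using assms by (intro add_mono frac) auto
  also have "\<dots> = (x powr a + y powr a) / (x + y) powr a"
    using assms s by (simp add: powr_divide add_divide_distrib)
  finally show ?thesis using s by (simp add: field_simps)
qed (use assms in simp)

lemma concave_on_powr:
  fixes a :: real
  assumes "0 \<le> a" "a \<le> 1"
  shows "concave_on {0<..} (\<lambda>x. x powr a)"
proof (rule f''_le0_imp_concave)
  fix x :: real assume "x \<in> {0<..}"
  then have x: "x > 0" by simp
  show "((\<lambda>x. x powr a) has_real_derivative a * x powr (a - 1)) (at x)"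
    using x by (auto intro!: derivative_eq_intros)
  show "((\<lambda>x. a * x powr (a - 1)) has_real_derivative a * ((a - 1) * x powr (a - 1 - 1))) (at x)"
    using x by (auto intro!: derivative_eq_intros)
  show "a * ((a - 1) * x powr (a - 1 - 1)) \<le> 0"
    using assms by (intro mult_nonneg_nonpos mult_nonpos_nonneg) auto
qed auto

section \<open>The lower bound\<close>

text \<open>The minorant for \<open>G\<close>, touching it at 2. Its constant is 3/2 times the
  claimed liminf, to undo the factor 2/3 between \<open>G\<close> and \<open>S30\<close>.\<close>

definition V :: "real \<Rightarrow> real" where
  "V x = sqrt 3 * x powr expo"

lemma V_scale: "y \<ge> 0 \<Longrightarrow> V (y * 4 ^ k) = V y * 3 ^ k"
  by (simp add: V_def powr_mult four_power_powr_expo)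

lemma V_mono: "0 \<le> x \<Longrightarrow> x \<le> y \<Longrightarrow> V x \<le> V y"
  using expo_bounds by (simp add: V_def powr_mono2)

lemma V_add: "0 \<le> x \<Longrightarrow> 0 \<le> y \<Longrightarrow> V (x + y) \<le> V x + V y"
  using powr_subadditive[of x y expo] expo_bounds
  by (simp add: V_def flip: distrib_left)

lemma V_double: "y \<ge> 0 \<Longrightarrow> V (2 * y) = 3 * y powr expo"
  by (simp add: V_def powr_mult two_powr_expo)

lemma V_values: "V 1 \<le> 2" "V 2 = 3" "V (3 / 2) \<le> 8 / 3" "V (15 / 4) \<le> 5" "V 4 \<le> 17 / 3"
proof -
  show "V 1 \<le> 2"
    by (simp add: V_def real_sqrt_le_iff[of 3 4, simplified] real_le_lsqrt)
  show "V 2 = 3" using V_double[of 1] by simp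
  have "(3 / 4) powr expo \<le> 8 / 9"
    by (rule powr_expo_bounds_le_1(2)) (simp_all add: power_divide)
  then show "V (3 / 2) \<le> 8 / 3" using V_double[of "3 / 4"] by simp
  have "(15 / 8) powr expo \<le> 5 / 3"
    by (rule powr_expo_bounds_ge_1(2)) (simp_all add: power_divide)
  then show "V (15 / 4) \<le> 5" using V_double[of "15 / 8"] by simp
  have "sqrt 3 \<le> 17 / 9" by (rule real_le_lsqrt) (simp_all add: power2_eq_square)
  then show "V 4 \<le> 17 / 3" using V_double[of 2] by (simp add: two_powr_expo)
qed

lemma V_cell:
  assumes "0 \<le> p" "real x \<le> p * 4 ^ k" "V p \<le> L"
  shows "V x \<le> L * 3 ^ k"
proof -
  have "V x \<le> V (p * 4 ^ k)" using assms by (intro V_mono) auto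
  also have "\<dots> = V p * 3 ^ k" using assms(1) by (rule V_scale)
  also have "\<dots> \<le> L * 3 ^ k" using assms by simp
  finally show ?thesis .
qed

text \<open>Induction on the number of base 4 digits. The leading digit 2 is critical: there
  \<open>G\<close> splits exactly and \<open>V\<close> is subadditive. The prefix 10 is treated
  likewise; in the other blocks starting with 1 or 3, \<open>V\<close> at the right end stays below
  a lower bound for \<open>G\<close>.\<close>

lemma V_le_G: "V (real x) \<le> G x"
proof -
  have "V (real x) \<le> G x" if "x \<le> 4 ^ k" for k
    using that
  proof (induction k arbitrary: x)
    case 0
    then have "x = 0 \<or> x = 1" by auto
    then show ?case using V_values by (auto simp: G_small V_def)
  next
    case (Suc k)
    obtain d r where d: "d \<in> {0, 1, 2, 3}" and r: "r \<le> 4 ^ k" and x: "x = d * 4 ^ k + r"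
      using split_block Suc.prems by metis
    have rr: "real r \<le> 4 ^ k" using r by (rule real_le_four_power)
    consider "d = 0" | "d = 1" | "d = 2" | "d = 3" using d by auto
    then show ?case
    proof cases
      case 1
      then show ?thesis using Suc.IH r x by simp
    next
      case 2
      then have Gx: "G x = 2 * 3 ^ k + C k r" using G_cells(1)[OF r] x by simp
      show ?thesis
      proof (cases k)
        case 0
        then have "x = 1 \<or> x = 2" using x r 2 by auto
        then show ?thesis using V_values by (auto simp: G_small)
      next
        case (Suc j)
        obtain e s where e: "e \<in> {0, 1, 2, 3}" and s: "s \<le> 4 ^ j" and rs: "r = e * 4 ^ j + s"
          using split_block r Suc by metis
        have ss: "real s \<le> 4 ^ j" using s by (rule real_le_four_power)
        consider "e = 0" | "e = 1" | "e \<in> {2, 3}" using e by auto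
        then show ?thesis
        proof cases
          case 1
          have "V x \<le> V (4 ^ k) + V r"
            using V_add[of "4 ^ k" r] x 2 by simp
          moreover have "V (4 ^ k) \<le> 2 * 3 ^ k"
            using V_cell[of 1 "4 ^ k" k 2] V_values by simp
          moreover have "C k r = G r"
            using C_cells(1)[OF s] 1 rs Suc by simp
          moreover have "V r \<le> G r" using Suc.IH r by blast
          ultimately show ?thesis using Gx by linarith
        next
          case 2
          have "real x \<le> 3 / 2 * 4 ^ k"
            using x rs ss 2 Suc \<open>d = 1\<close> by simp
          then have "V x \<le> 8 / 3 * 3 ^ k" using V_values by (intro V_cell) auto
          moreover have "C k r \<ge> 2 * 3 ^ j"
            using C_cells(2)[OF s] C_nonneg[OF s] 2 rs Suc by simp
          ultimately show ?thesis using Gx Suc by simp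
        next
          case 3
          have "real x \<le> 2 * 4 ^ k"
            using x rr \<open>d = 1\<close> by simp
          then have "V x \<le> 3 * 3 ^ k" using V_values by (intro V_cell) auto
          moreover have "C k r \<ge> 3 * 3 ^ j"
            using C_cells(3,4)[OF s] C_nonneg[OF s] B_le[OF s] 3 rs Suc by auto
          ultimately show ?thesis using Gx Suc by simp
        qed
      qed
    next
      case 3
      have "V x \<le> V (2 * 4 ^ k) + V r"
        using V_add[of "2 * 4 ^ k" r] x 3 by simp
      moreover have "V (2 * 4 ^ k) = 3 * 3 ^ k"
        using V_scale[of 2 k] V_values by simp
      moreover have "V r \<le> G r" using Suc.IH r by blast
      ultimately show ?thesis using G_cells(2)[OF r] x 3 by simp
    next
      case 4
      have Gx: "G x = 5 * 3 ^ k + B k r" using G_cells(3)[OF r] x 4 by simp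
      show ?thesis
      \<comment> \<open>\<open>V 4\<close> exceeds 5, so the height 5 at the start of the block does
        not cover all of it; the last quarter gains 2/3, giving 17/3.\<close>
      proof (cases "4 * r \<le> 3 * 4 ^ k")
        case True
        then have "real (4 * r) \<le> real (3 * 4 ^ k)" by (simp only: of_nat_le_iff)
        then have "real x \<le> 15 / 4 * 4 ^ k" using x 4 by simp
        then have "V x \<le> 5 * 3 ^ k" using V_values by (intro V_cell) auto
        then show ?thesis using Gx B_nonneg[OF r] by simp
      next
        case False
        have "real x \<le> 4 * 4 ^ k" using x 4 rr by simp
        then have "V x \<le> 17 / 3 * 3 ^ k" using V_values by (intro V_cell) auto
        then show ?thesis using Gx B_ge_final[of k r] r False by simp
      qed
    qed
  qed
  moreover have "x \<le> 4 ^ x" using less_exp[of x] power_mono[of 2 "4::nat" x] by linarith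
  ultimately show ?thesis by blast
qed

section \<open>The upper bound\<close>

text \<open>The majorant for \<open>G\<close>, normalised to be 55/2 at the extremal point
  65/3.\<close>

definition U :: "real \<Rightarrow> real" where
  "U x = 55 / 2 * (3 * x / 65) powr expo"

lemma U_scale:
  assumes "y \<ge> 0"
  shows "U (y * 4 ^ k) = U y * 3 ^ k"
proof -
  have "(3 * (y * 4 ^ k) / 65) powr expo = ((3 * y / 65) * 4 ^ k) powr expo"
    by (simp add: mult_ac)
  also have "\<dots> = (3 * y / 65) powr expo * 3 ^ k"
    using assms by (subst powr_mult) (simp_all add: four_power_powr_expo)
  finally show ?thesis by (simp add: U_def)
qed

lemma U_mono: "0 \<le> x \<Longrightarrow> x \<le> y \<Longrightarrow> U x \<le> U y"
  using expo_bounds by (simp add: U_def powr_mono2)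

lemma U_cell:
  assumes "0 \<le> p" "p * 4 ^ k \<le> real x" "L \<le> U p" "g \<le> L * 3 ^ k"
  shows "g \<le> U x"
proof -
  have "g \<le> L * 3 ^ k" by fact
  also have "\<dots> \<le> U p * 3 ^ k" using assms by simp
  also have "\<dots> = U (p * 4 ^ k)" using assms by (simp add: U_scale)
  also have "\<dots> \<le> U x" using assms by (intro U_mono) auto
  finally show ?thesis .
qed

lemma U_ge_left:
  assumes "0 < p" "3 * p \<le> 65" "(2 * L / 55) ^ 5 \<le> (3 * p / 65) ^ 4"
  shows "L \<le> U p"
  using powr_expo_bounds_le_1(1)[of "3 * p / 65" "2 * L / 55"] assms by (simp add: U_def)

lemma U_ge_right:
  assumes "65 \<le> 3 * p" "(2 * L / 55) ^ 24 \<le> (3 * p / 65) ^ 19"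
  shows "L \<le> U p"
  using powr_expo_bounds_ge_1(1)[of "3 * p / 65" "2 * L / 55"] assms by (simp add: U_def)

text \<open>
  The comparison at \<open>68 / 3\<close>, a second near-maximum, is the tightest: the two sides agree up to
  a factor of about \<open>1.00004\<close>.
\<close>

lemma U_values:
  "43 / 2 \<le> U 16" "23 \<le> U 18" "24 \<le> U 19" "77 / 3 \<le> U 20" "26 \<le> U (83 / 4)" "107 / 4 \<le> U 21"
  "55 / 2 \<le> U (65 / 3)" "111 / 4 \<le> U 22" "57 / 2 \<le> U (68 / 3)" "28 \<le> U 23" "29 \<le> U 24"
  "61 / 2 \<le> U 25" "63 / 2 \<le> U 26" "30 \<le> U 28" "33 \<le> U 32" "75 / 2 \<le> U 36" "42 \<le> U 40"
  "45 \<le> U 44" "51 \<le> U 48" "54 \<le> U 52"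
  by (rule U_ge_left; simp add: power_divide; fail | rule U_ge_right; simp add: power_divide)+

lemma U_chord:
  assumes "0 < p" "p \<le> y" "y \<le> q" "p < q" "K \<le> U p" "L \<le> U q"
  shows "K + (L - K) * ((y - p) / (q - p)) \<le> U y"
proof -
  define t where "t = (y - p) / (q - p)"
  have t: "0 \<le> t" "t \<le> 1" using assms by (simp_all add: t_def)
  have "t * (q - p) = y - p" using assms by (simp add: t_def)
  then have y: "y = (1 - t) * p + t * q" by (simp add: algebra_simps)
  have "3 * y / 65 = (1 - t) * (3 * p / 65) + t * (3 * q / 65)"
    unfolding y by (simp add: field_simps)
  moreover have "((1 - t) * (3 * p / 65) + t * (3 * q / 65)) powr expo
      \<ge> (1 - t) * (3 * p / 65) powr expo + t * (3 * q / 65) powr expo"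
    using concave_onD[OF concave_on_powr[of expo], of t "3 * p / 65" "3 * q / 65"] expo_bounds assms t
    by simp
  ultimately have "(1 - t) * (3 * p / 65) powr expo + t * (3 * q / 65) powr expo
      \<le> (3 * y / 65) powr expo"
    by (simp only:)
  from mult_left_mono[OF this, of "55 / 2"]
  have "(1 - t) * U p + t * U q \<le> U y"
    unfolding U_def by (simp only: distrib_left mult_ac)
  moreover have "(1 - t) * K + t * L \<le> (1 - t) * U p + t * U q"
    using t assms by (intro add_mono mult_left_mono) auto
  ultimately show ?thesis unfolding t_def[symmetric] by (simp add: algebra_simps)
qed

text \<open>Two comparisons settle a whole block of pattern C. Up to two thirds of the block the
  linear bound for \<open>C\<close>, of slope 9/8 = (3/2 - 3/4) / (2/3), is a chord below the
  concave \<open>U\<close>; after that the constant bound stays below the increasing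
  \<open>U\<close>.\<close>

lemma U_C_cell:
  fixes m :: nat
  assumes r: "r \<le> 4 ^ k" and "0 < m" and low: "c + 3 / 4 \<le> U m" and high: "c + 3 / 2 \<le> U (m + 2 / 3)"
  shows "c * 3 ^ k + C k r \<le> U (m * 4 ^ k + r)"
proof -
  define t where "t = real r / 4 ^ k"
  have r_eq: "real r = t * 4 ^ k" by (simp add: t_def)
  have x_eq: "real m * 4 ^ k + real r = (m + t) * 4 ^ k" by (simp add: r_eq algebra_simps)
  show ?thesis
  proof (cases "t \<le> 2 / 3")
    case True
    have t: "0 \<le> t" by (simp add: t_def)
    have "c * 3 ^ k + C k r \<le> (c + 3 / 4 + 9 / 8 * t) * 3 ^ k"
      using C_le_linear[OF r] by (simp add: t_def algebra_simps)
    also have "c + 3 / 4 + 9 / 8 * t \<le> U (m + t)"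
      using U_chord[of m "m + t" "m + 2 / 3", OF _ _ _ _ low high] t True \<open>0 < m\<close>
      by (simp add: algebra_simps)
    also have "U (m + t) * 3 ^ k = U (m * 4 ^ k + r)"
      using t x_eq U_scale[of "m + t" k] by simp
    finally show ?thesis by simp
  next
    case False
    have "c * 3 ^ k + C k r \<le> (c + 3 / 2) * 3 ^ k"
      using C_le[OF r] by (simp add: algebra_simps)
    also have "c + 3 / 2 \<le> U (m + t)"
      using high U_mono[of "m + 2 / 3" "m + t"] False by simp
    also have "U (m + t) * 3 ^ k = U (m * 4 ^ k + r)"
      using False x_eq U_scale[of "m + t" k] by simp
    finally show ?thesis by simp
  qed
qed

text \<open>Three base 4 digits select a block from 16 to 63. Comparing an upper bound for
  \<open>G\<close> with \<open>U\<close> at the left end suffices except near the maximum: block 20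
  is cut at three quarters, and blocks 21 and 22 use the chord.\<close>

lemma G_le_U_block:
  assumes "16 * 4 ^ k \<le> x" "x \<le> 64 * 4 ^ k"
  shows "G x \<le> U x"
proof -
  have T: "(0::real) < 3 ^ k" by simp
  have "x \<le> 4 ^ Suc (Suc (Suc k))" using assms by simp
  then obtain d r where d: "d \<in> {0, 1, 2, 3}" and r: "r \<le> 4 ^ Suc (Suc k)"
    and x: "x = d * 4 ^ Suc (Suc k) + r"
    using split_block by metis
  obtain e s where e: "e \<in> {0, 1, 2, 3}" and s: "s \<le> 4 ^ Suc k" and rs: "r = e * 4 ^ Suc k + s"
    using split_block r by metis
  obtain f u where f: "f \<in> {0, 1, 2, 3}" and u: "u \<le> 4 ^ k" and su: "s = f * 4 ^ k + u"
    using split_block s by metis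
  have xr: "real x = (16 * d + 4 * e + f) * 4 ^ k + u"
    by (simp add: x rs su algebra_simps)
  have xr_ge: "(16 * real d + 4 * e) * 4 ^ k \<le> x"
    unfolding xr by (simp add: distrib_right)
  have bounds: "G s \<le> 6 * 3 ^ k" "C (Suc k) s \<le> 9 / 2 * 3 ^ k" "0 \<le> C (Suc k) s"
    "0 \<le> B (Suc k) s" "B (Suc k) s \<le> 3 * 3 ^ k"
    using block_bounds[OF s] by auto
  note cells = G_cells[OF r] C_cells[OF s] B_cells[OF s] G_cells[OF s] G_cells[OF u] C_cells[OF u]
  consider "d = 0" | "d = 1" "e = 0" | "d = 1" "e = 1" | "d = 1" "e = 2" | "d = 1" "e = 3"
    | "d = 2" | "d = 3" using d e by auto
  then show ?thesis
  proof cases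
    case 1
    \<comment> \<open>Because blocks are closed, the leading digit 0 still admits this one boundary
      point.\<close>
    then have "x = 4 ^ Suc (Suc k)" using x r assms by simp
    then have "d = 0" "G x = 18 * 3 ^ k" "real x = 16 * 4 ^ k"
      using 1 G_power[of "Suc (Suc k)" 1] by (simp_all add: G_small)
    then show ?thesis
      using U_values(1) by (intro U_cell[of 16 k x "43 / 2"]) auto
  next
    case 2
    then have Gx: "G x = 18 * 3 ^ k + G s" using x rs cells by simp
    consider "f \<in> {0, 1}" | "f = 2" | "f = 3" using f by auto
    then show ?thesis
    proof cases
      case 1
      then have "G s \<le> 2 * 3 ^ k \<or> G s \<le> 2 * 3 ^ k + 3 / 2 * 3 ^ k"
        using su cells G_le[OF u] C_le[OF u] by auto
      then have "G s \<le> 7 / 2 * 3 ^ k" using T by linarith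
      then show ?thesis
        using Gx xr_ge 2 U_values
        by (intro U_cell[of 16 k x "43 / 2"]) auto
    next
      case f2: 2
      then have "G s \<le> 5 * 3 ^ k" using su cells G_le[OF u] by simp
      then show ?thesis
        using Gx xr 2 f2 U_values by (intro U_cell[of 18 k x 23]) auto
    next
      case 3
      then show ?thesis
        using Gx xr 2 bounds U_values by (intro U_cell[of 19 k x 24]) auto
    qed
  next
    case 3
    then have Gx: "G x = 24 * 3 ^ k + C (Suc k) s" using x rs cells by simp
    consider "f = 0" | "f = 1" | "f = 2" | "f = 3" using f by auto
    then show ?thesis
    proof cases
      case 1
      then have Cs: "C (Suc k) s = G u" using su cells by simp
      show ?thesis
      \<comment> \<open>\<open>U 20\<close> lies below 26 = 24 + 2, so the general bound
        \<open>2 * 3 ^ k\<close> for \<open>G u\<close> works only further to the right.\<close>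
      proof (cases "4 * u \<le> 3 * 4 ^ k")
        case True
        then show ?thesis
          using Gx Cs xr 3 1 U_values G_le_initial[OF True] by (intro U_cell[of 20 k x "77 / 3"]) auto
      next
        case False
        then have "real (3 * 4 ^ k) \<le> real (4 * u)" by (simp only: of_nat_le_iff)
        then show ?thesis
          using Gx Cs xr 3 1 U_values G_le[OF u] by (intro U_cell[of "83 / 4" k x 26]) auto
      qed
    next
      case 2
      \<comment> \<open>This block contains the extremal point: 26 + 3/2 equals
        \<open>U (65 / 3)\<close>, with no room to spare.\<close>
      then have "G x = 26 * 3 ^ k + C k u" using Gx su cells by simp
      then show ?thesis
        using U_C_cell[OF u, of 21 26] U_values xr 3 2 by simp
    next
      case f3: 3
      then have "G x = 27 * 3 ^ k + C k u" using Gx su cells by simp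
      then show ?thesis
        using U_C_cell[OF u, of 22 27] U_values xr 3 f3 by simp
    next
      case 4
      then have "G x \<le> 28 * 3 ^ k" using Gx su cells B_nonneg[OF u] by simp
      then show ?thesis
        using xr 3 4 U_values by (intro U_cell[of 23 k x 28]) auto
    qed
  next
    case 4
    then have Gx: "G x = 27 * 3 ^ k + C (Suc k) s" using x rs cells by simp
    consider "f = 0" | "f = 1" | "f \<in> {2, 3}" using f by auto
    then show ?thesis
    proof cases
      case 1
      then show ?thesis
        using Gx xr 4 U_values su cells G_le[OF u] by (intro U_cell[of 24 k x 29]) auto
    next
      case 2
      then show ?thesis
        using Gx xr 4 U_values su cells C_le[OF u] by (intro U_cell[of 25 k x "61 / 2"]) auto
    next
      case 3
      then show ?thesis
        using Gx xr 4 U_values bounds by (intro U_cell[of 26 k x "63 / 2"]) auto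
    qed
  next
    case 5
    then have "G x \<le> 30 * 3 ^ k" using x rs cells bounds by simp
    then show ?thesis
      using xr_ge 5 U_values by (intro U_cell[of 28 k x 30]) auto
  next
    case 6
    then have Gx: "G x = 27 * 3 ^ k + G r" using x cells by simp
    consider "e = 0" | "e = 1" | "e = 2" | "e = 3" using e by auto
    then show ?thesis
    proof cases
      case 1
      then show ?thesis
        using Gx xr_ge 6 U_values rs cells bounds by (intro U_cell[of 32 k x 33]) auto
    next
      case 2
      then show ?thesis
        using Gx xr_ge 6 U_values rs cells bounds by (intro U_cell[of 36 k x "75 / 2"]) auto
    next
      case 3
      then show ?thesis
        using Gx xr_ge 6 U_values rs cells bounds by (intro U_cell[of 40 k x 42]) auto
    next
      case 4
      then show ?thesis
        using Gx xr_ge 6 U_values rs cells bounds by (intro U_cell[of 44 k x 45]) auto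
    qed
  next
    case 7
    then have Gx: "G x = 45 * 3 ^ k + B (Suc (Suc k)) r" using x cells by simp
    consider "e = 0" | "e \<ge> 1" using e by auto
    then show ?thesis
    proof cases
      case 1
      then show ?thesis
        using Gx xr_ge 7 U_values rs cells bounds by (intro U_cell[of 48 k x 51]) auto
    next
      case 2
      have "52 * 4 ^ k \<le> (16 * real d + 4 * e) * (4 ^ k :: real)"
        using 2 7 by (intro mult_right_mono) auto
      then have "52 * 4 ^ k \<le> real x" using xr_ge by linarith
      then show ?thesis
        using Gx U_values B_le[OF r] by (intro U_cell[of 52 k x 54]) auto
    qed
  qed
qed

text \<open>Multiplying \<open>x\<close> by 16 multiplies both sides by 9 and supplies the three
  digits for the case analysis.\<close>

lemma G_le_U:
  assumes "x > 0"
  shows "G x \<le> U x"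
proof -
  obtain k where k: "4 ^ k \<le> x" "x < 4 ^ Suc k"
    using ex_power_ivl1[of 4 x] assms by auto
  have "G (4 ^ 2 * x) \<le> U (real (4 ^ 2 * x))"
    using k by (intro G_le_U_block[of k]) auto
  then show ?thesis
    using G_power[of 2 x] U_scale[of x 2] by (simp add: mult.commute)
qed

section \<open>Extremal sequences and passage to the limit\<close>

lemma powr_neg_expo_tendsto_0: "(\<lambda>x. real x powr (- expo)) \<longlonglongrightarrow> 0"
  using expo_bounds by (intro tendsto_neg_powr filterlim_real_sequentially) auto

text \<open>Integer approximations from below to $\frac{65}{3} 4^k$, obtained by appending digits 2.\<close>

fun peak :: "nat \<Rightarrow> nat" where
  "peak 0 = 21"
| "peak (Suc k) = 4 * peak k + 2"

lemma strict_mono_peak: "strict_mono peak"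
  by (simp add: strict_mono_Suc_iff)

lemma peak_eq: "3 * peak k + 2 = 65 * 4 ^ k"
  by (induction k) auto

text \<open>The digit 2 maps pattern C to itself, so each step sends \<open>g\<close> to
  \<open>3 * g + 3\<close>, an affine map with fixed point -3/2.\<close>

lemma G_peak: "G (peak k) = 55 / 2 * 3 ^ k - 3 / 2"
proof -
  have "eps (3 * peak k) = 1 \<and> eps (3 * peak k + 1) = - 1 \<and> eps (3 * peak k + 2) = 1" for k
  proof (induction k)
    case (Suc k)
    then show ?case
      by (simp only: peak.simps eps_child) simp
  qed simp
  then have e: "eps (3 * peak k) = 1" for k
    by blast
  show ?thesis
  proof (induction k)
    case 0
    show ?case
      using G_child(1)[of 5] by (simp add: G_small)
  next
    case (Suc k)
    then show ?case
      using G_child(2)[of "peak k"] e[of k] by simp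
  qed
qed

theorem mainTheorem2:
  fixes lam :: real
  defines "lam \<equiv> ln 3 / ln 4"
  shows "limsup (\<lambda>x::nat. ereal (real_of_int (S30 (3 * x)) * real x powr (- lam)))
           = ereal (55 / 3 * (3 / 65) powr lam) \<and>
         liminf (\<lambda>x::nat. ereal (real_of_int (S30 (3 * x)) * real x powr (- lam)))
           = ereal (2 * sqrt 3 / 3)"
proof -
  have lam: "lam = expo" by (simp add: lam_def expo_def)
  define h where "h x = real_of_int (S30 (3 * x)) * real x powr (- expo)" for x :: nat
  define K where "K = 55 / 3 * (3 / 65) powr expo"
  \<comment> \<open>\<open>2 * G x\<close> is \<open>S30 (3 * (4 * x))\<close>, so this is the
    quadrupling error.\<close>
  have S: "2 * G x - 1 \<le> 3 * real_of_int (S30 (3 * x))" "3 * real_of_int (S30 (3 * x)) \<le> 2 * G x + 1" for x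
    using S30_quad_bound[of x] by (simp_all add: G_def)
  have upper: "h x \<le> K + real x powr (- expo)" if "x > 0" for x
  proof -
    have "real_of_int (S30 (3 * x)) \<le> 2 / 3 * U x + 1"
      using S(2)[of x] G_le_U[OF that] by simp
    then have "h x \<le> (2 / 3 * U x + 1) * real x powr (- expo)"
      unfolding h_def by (intro mult_right_mono) auto
    also have "U x = 55 / 2 * (3 / 65) powr expo * real x powr expo"
      by (simp add: U_def powr_mult powr_divide)
    also have "(2 / 3 * (55 / 2 * (3 / 65) powr expo * real x powr expo) + 1) * real x powr (- expo)
        = K + real x powr (- expo)"
      using that by (simp add: K_def powr_minus field_simps)
    finally show ?thesis .
  qed
  have lower: "2 * sqrt 3 / 3 - real x powr (- expo) \<le> h x" if "x > 0" for x
  proof -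
    have "2 * sqrt 3 / 3 - real x powr (- expo) = (2 / 3 * V x - 1) * real x powr (- expo)"
      using that by (simp add: V_def powr_minus field_simps)
    also have "2 / 3 * V x - 1 \<le> real_of_int (S30 (3 * x))"
      using S(1)[of x] V_le_G[of x] by simp
    finally show ?thesis
      unfolding h_def by (simp add: mult_right_mono)
  qed
  have pos: "eventually (\<lambda>x::nat. x > 0) sequentially"
    by (rule eventually_gt_at_top)
  have limsup_le: "limsup (\<lambda>x. ereal (h x)) \<le> ereal K"
  proof -
    have "limsup (\<lambda>x. ereal (h x)) \<le> limsup (\<lambda>x. ereal (K + real x powr (- expo)))"
      by (intro Limsup_mono eventually_mono[OF pos]) (simp add: upper)
    also have "(\<lambda>x. ereal (K + real x powr (- expo))) \<longlonglongrightarrow> ereal (K + 0)"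
      by (intro tendsto_ereal tendsto_add tendsto_const powr_neg_expo_tendsto_0)
    then have "limsup (\<lambda>x. ereal (K + real x powr (- expo))) = ereal K"
      by (intro lim_imp_Limsup) auto
    finally show ?thesis .
  qed
  have liminf_ge: "ereal (2 * sqrt 3 / 3) \<le> liminf (\<lambda>x. ereal (h x))"
  proof -
    have "(\<lambda>x. ereal (2 * sqrt 3 / 3 - real x powr (- expo))) \<longlonglongrightarrow> ereal (2 * sqrt 3 / 3 - 0)"
      by (intro tendsto_ereal tendsto_diff tendsto_const powr_neg_expo_tendsto_0)
    then have "ereal (2 * sqrt 3 / 3) = liminf (\<lambda>x. ereal (2 * sqrt 3 / 3 - real x powr (- expo)))"
      by (intro lim_imp_Liminf[symmetric]) auto
    also have "\<dots> \<le> liminf (\<lambda>x. ereal (h x))"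
      by (intro Liminf_mono eventually_mono[OF pos]) (simp add: lower)
    finally show ?thesis .
  qed
  have limsup_ge: "ereal K \<le> limsup (\<lambda>x. ereal (h x))"
  proof -
    \<comment> \<open>At \<open>peak k\<close>, \<open>3 * S30\<close> is at least
      \<open>2 * G - 1\<close>, that is \<open>55 * 3 ^ k - 4\<close>; hence the term 4/3.\<close>
    define l where "l k = (55 / 3 - 4 / 3 * (1 / 3) ^ k) * (3 / 65) powr expo" for k :: nat
    have "l k \<le> h (peak k)" for k
    proof -
      have "3 * real (peak k) + 2 = 65 * 4 ^ k"
        using arg_cong[OF peak_eq[of k], of real] by simp
      moreover have "21 \<le> peak k" by (induction k) auto
      ultimately have p: "0 < real (peak k)" "real (peak k) \<le> 65 / 3 * 4 ^ k" by auto
      have "(3 / 65) powr expo / 3 ^ k = (65 / 3 * 4 ^ k) powr (- expo)"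
      proof -
        have "(65 / 3 * 4 ^ k) powr expo = (65 / 3) powr expo * 3 ^ k"
          by (subst powr_mult) (simp_all add: four_power_powr_expo)
        moreover have "(3 / 65) powr expo = inverse ((65 / 3) powr expo)"
          by (simp add: powr_divide)
        ultimately show ?thesis
          by (simp add: powr_minus field_simps)
      qed
      also have "\<dots> \<le> real (peak k) powr (- expo)"
        using p expo_bounds by (intro powr_mono2') auto
      finally have le: "(3 / 65) powr expo / 3 ^ k \<le> real (peak k) powr (- expo)" .
      have "(1::real) \<le> 3 ^ k" by simp
      then have nonneg: "0 \<le> 55 / 3 * 3 ^ k - 4 / (3::real)" by linarith
      have "l k = (55 / 3 * 3 ^ k - 4 / 3) * ((3 / 65) powr expo / 3 ^ k)"
        by (simp add: l_def field_simps)
      also have "\<dots> \<le> (55 / 3 * 3 ^ k - 4 / 3) * real (peak k) powr (- expo)"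
        using nonneg le by (rule mult_left_mono[rotated])
      also have "\<dots> \<le> h (peak k)"
        unfolding h_def using S(1)[of "peak k"] by (intro mult_right_mono) (auto simp: G_peak)
      finally show ?thesis .
    qed
    then have "limsup (\<lambda>k. ereal (l k)) \<le> limsup ((\<lambda>x. ereal (h x)) \<circ> peak)"
      by (intro Limsup_mono) auto
    also have "\<dots> \<le> limsup (\<lambda>x. ereal (h x))"
      using strict_mono_peak by (rule limsup_subseq_mono)
    also have "l \<longlonglongrightarrow> (55 / 3 - 4 / 3 * 0) * (3 / 65) powr expo"
      unfolding l_def by (intro tendsto_intros LIMSEQ_power_zero) auto
    then have "limsup (\<lambda>k. ereal (l k)) = ereal K"
      by (intro lim_imp_Limsup tendsto_ereal) (auto simp: K_def)
    finally show ?thesis .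
  qed
  have liminf_le: "liminf (\<lambda>x. ereal (h x)) \<le> ereal (2 * sqrt 3 / 3)"
  proof -
    \<comment> \<open>These arguments are even, so quadrupling is exact and the ratio equals the
      claimed liminf at every scale.\<close>
    define b where "b k = 2 * (4::nat) ^ k" for k :: nat
    have "strict_mono b" by (simp add: b_def strict_mono_Suc_iff)
    have "h (b k) = 2 * sqrt 3 / 3" for k
    proof -
      have "S30 (3 * b k) = 2 * 3 ^ k"
      proof (induction k)
        case 0
        show ?case
          using S30_block(2)[of 0] by (simp add: b_def)
      next
        case (Suc k)
        then show ?case
          using S30_quad_even[of "4 ^ k"] by (simp add: b_def mult_ac)
      qed
      moreover have "real (b k) powr expo = sqrt 3 * 3 ^ k"
        by (simp add: b_def powr_mult two_powr_expo four_power_powr_expo)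
      ultimately show ?thesis
        by (simp add: h_def powr_minus field_simps)
    qed
    then have "liminf ((\<lambda>x. ereal (h x)) \<circ> b) = ereal (2 * sqrt 3 / 3)"
      by (simp only: o_def) (simp add: Liminf_const)
    then show ?thesis
      using liminf_subseq_mono[OF \<open>strict_mono b\<close>, of "\<lambda>x. ereal (h x)"] by simp
  qed
  show ?thesis
    using limsup_le limsup_ge liminf_le liminf_ge unfolding lam h_def K_def by simp
qed

end
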